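(* For every integer $m\geq 0$, $$\sum_{k=2}^{\infty}\frac{(k+1)(\zeta(k)-1)}{k}L_{k+m}=2(1-\gamma)L_{m+1}+\alpha^m\left(\ln\Gamma(\beta^2)-\alpha\,\psi^{(0)}(\beta^2)\right)+\beta^m\left(\ln\Gamma(\alpha^2)-\beta\,\psi^{(0)}(\alpha^2)\right)$$ and $$\sum_{k=2}^{\infty}\frac{(k+1)(\zeta(k)-1)}{k}F_{k+m}=2(1-\gamma)F_{m+1}+\frac{\alpha^m}{\sqrt5}\left(\ln\Gamma(\beta^2)-\alpha\,\psi^{(0)}(\beta^2)\right)-\frac{\beta^m}{\sqrt5}\left(\ln\Gamma(\alpha^2)-\beta\,\psi^{(0)}(\alpha^2)\right).$$
   Context: $\zeta$ denotes the Riemann zeta function, $\Gamma$ the gamma function, $\psi^{(0)}(z)=\Gamma'(z)/\Gamma(z)$ the digamma function, and $\gamma$ the Euler-Mascheroni constant. $\alpha=\frac{1+\sqrt5}{2}$ and $\beta=\frac{1-\sqrt5}{2}$. $F_n$ and $L_n$ denote the Fibonacci and Lucas numbers: both satisfy $x_n=x_{n-1}+x_{n-2}$ for $n\ge 2$, with $F_0=0$, $F_1=1$ and $L_0=2$, $L_1=1$. *)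

theory Defs
  imports "HOL-Analysis.Analysis" "HOL-Number_Theory.Fib"
begin

(* The Riemann zeta function on the half-line s > 1, where it is given by its Dirichlet
   series. For s <= 1 the series diverges and the value is not meaningful. *)
definition zeta :: "real \<Rightarrow> real" where
  "zeta s = (\<Sum>n. 1 / real (Suc n) powr s)"

fun lucas :: "nat \<Rightarrow> nat" where
  "lucas 0 = 2"
| "lucas (Suc 0) = 1"
| "lucas (Suc (Suc n)) = lucas (Suc n) + lucas n"

definition alpha :: real ("\<alpha>") where
  "\<alpha> = (1 + sqrt 5) / 2"

definition beta :: real ("\<beta>") where
  "\<beta> = (1 - sqrt 5) / 2"

end

theory Submission
  imports Defs
begin

text \<open>
  By Binet's formulas both series are linear combinations, with coefficients $\alpha^m$ and
  $\beta^m$, of the power series $\sum_{k \ge 2} \frac{k+1}{k} (\zeta(k) - 1) x^k$ at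
  $x = \alpha$ and $x = \beta$. Since $\zeta(k) - 1 = \sum_{n \ge 2} n^{-k}$, this power series
  converges for $|x| < 2$, a range that contains both points, and there the double series may be
  summed over $k$ first. Writing $\frac{k+1}{k} = 1 + \frac1k$, each $n \ge 2$ then contributes
  $\frac{x}{n-x} - \frac xn$ from the geometric series and $-\ln(1 - \frac xn) - \frac xn$ from
  the logarithmic series.

  The sum over $n$ of the first part is the partial fraction series of the digamma function at
  $2 - x$; that of the second part is the logarithm of the product formula for
  $\Gamma(2 - x)$. In each case the subtracted terms $\frac xn$ compensate the divergence and
  leave behind $(1 - \gamma) x$, so that the power series equals
  $2 (1 - \gamma) x + \ln \Gamma(2 - x) - x \psi^{(0)}(2 - x)$
  (lemma \<open>zeta_minus_one_power_series\<close>). Finally $2 - \alpha = \beta^2$ and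
  $2 - \beta = \alpha^2$.
\<close>

section \<open>Sums of simple fractions and the gamma function\<close>

text \<open>
  The constant $1 - \gamma$ arises because the harmonic sums here start at $\frac12$.
\<close>
lemma shifted_harmonic_LIMSEQ:
  "(\<lambda>m. (\<Sum>n<m. 1 / (real n + 2)) - ln (real m)) \<longlonglongrightarrow> euler_mascheroni - 1"
proof -
  have part: "(\<Sum>n<m. 1 / (real n + 2)) = harm m + 1 / (real m + 1) - 1" for m
    by (induction m) (simp_all add: harm_Suc harm_expand(1) inverse_eq_divide add_ac)
  have "(\<lambda>m. (harm m - ln (real m)) + 1 / (real m + 1) - 1)
      \<longlonglongrightarrow> euler_mascheroni + 0 - 1"
    using LIMSEQ_inverse_real_of_nat
    by (intro tendsto_intros euler_mascheroni_LIMSEQ) (simp add: field_simps)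
  then show ?thesis
    by (simp add: part algebra_simps)
qed

lemma Digamma_partial_fractions:
  fixes x :: real
  assumes "x \<noteq> 2"
  shows "(\<lambda>n. x / (real n + 2 - x) - x / (real n + 2))
    sums (x * (1 - euler_mascheroni - Digamma (2 - x)))"
proof -
  have "(\<lambda>m. - x * ((\<Sum>n<m. 1 / (real n + 2)) - ln (real m))
        - x * (ln (real m) - (\<Sum>n<m. inverse (2 - x + real n))))
      \<longlonglongrightarrow> - x * (euler_mascheroni - 1) - x * Digamma (2 - x)"
    using assms Digamma_LIMSEQ[of "2 - x"]
    by (intro tendsto_intros shifted_harmonic_LIMSEQ) simp
  also have "(\<lambda>m. - x * ((\<Sum>n<m. 1 / (real n + 2)) - ln (real m))
        - x * (ln (real m) - (\<Sum>n<m. inverse (2 - x + real n))))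
      = (\<lambda>m. \<Sum>n<m. x / (real n + 2 - x) - x / (real n + 2))"
    by (simp add: sum_subtractf sum_negf sum_distrib_left algebra_simps inverse_eq_divide)
  finally show ?thesis
    by (simp add: sums_def algebra_simps)
qed

text \<open>
  Gauss's product for $\Gamma(2 - x)$ has the factors
  $1 + \frac{2-x}{k} = \frac{k+2}{k} (1 - \frac{x}{k+2})$; the numbers $\frac{k+2}{k}$
  telescope, and only the factors $1 - \frac{x}{k+2}$ remain.
\<close>
lemma ln_Gamma_series_two_minus:
  fixes x :: real
  assumes "x < 2" "m > 0"
  shows "ln_Gamma_series (2 - x) m
    = (2 - x) * ln (real m) - (ln (real m + 1) + ln (real m + 2))
      - (\<Sum>n<Suc m. ln (1 - x / (real n + 2)))"
proof -
  have "ln (2 - x) + (\<Sum>k=1..m. ln ((2 - x) / real k + 1))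
      = ln (real m + 1) + ln (real m + 2) + (\<Sum>n<Suc m. ln (1 - x / (real n + 2)))" for m
  proof (induction m)
    case 0
    have "ln (2 - x) = ln (2 * (1 - x / 2))"
      by (simp add: algebra_simps)
    also have "\<dots> = ln 2 + ln (1 - x / 2)"
      using assms by (subst ln_mult_pos) auto
    finally show ?case by simp
  next
    case (Suc m)
    have "(2 - x) / real (Suc m) + 1
        = (real m + 3) / (real m + 1) * (1 - x / (real (Suc m) + 2))"
    proof -
      have "1 - x / (real (Suc m) + 2) = (real m + 3 - x) / (real m + 3)"
        "(2 - x) / real (Suc m) + 1 = (real m + 3 - x) / (real m + 1)"
        by (simp_all add: diff_divide_distrib add_divide_eq_iff add_ac)
      then show ?thesis
        by simp
    qed
    also have "ln \<dots> = ln (real m + 3) - ln (real m + 1) + ln (1 - x / (real (Suc m) + 2))"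
      using assms by (subst ln_mult_pos) (auto simp: ln_div field_simps)
    finally have "ln ((2 - x) / real (Suc m) + 1)
      = ln (real m + 3) - ln (real m + 1) + ln (1 - x / (real (Suc m) + 2))" .
    then show ?case
      using Suc by (simp add: add_ac)
  qed
  from this[of m] show ?thesis
    by (simp add: ln_Gamma_series_def)
qed

lemma ln_Gamma_logarithmic_series:
  fixes x :: real
  assumes "x < 2"
  shows "(\<lambda>n. - ln (1 - x / (real n + 2)) - x / (real n + 2))
    sums ((1 - euler_mascheroni) * x + ln (Gamma (2 - x)))"
proof -
  let ?h = "\<lambda>m. (\<Sum>n<m. 1 / (real n + 2)) - ln (real m)"
  let ?f = "\<lambda>n. - ln (1 - x / (real n + 2)) - x / (real n + 2)"
  have ratio: "(\<lambda>m. ln ((real m + c) / real m)) \<longlonglongrightarrow> 0" if "c > 0" for c :: real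
  proof -
    have "(\<lambda>m. 1 + c / real m) \<longlonglongrightarrow> 1 + 0"
      by (intro tendsto_intros lim_const_over_n)
    then have "(\<lambda>m. ln (1 + c / real m)) \<longlonglongrightarrow> ln 1"
      by (intro tendsto_ln) auto
    moreover have "\<forall>\<^sub>F m in sequentially. ln (1 + c / real m) = ln ((real m + c) / real m)"
      using eventually_gt_at_top[of 0] by eventually_elim (simp add: add_divide_distrib)
    ultimately show ?thesis
      by (simp add: tendsto_cong)
  qed
  have gamma: "ln_Gamma_series (2 - x) \<longlonglongrightarrow> ln (Gamma (2 - x))"
    using ln_Gamma_real_LIMSEQ[of "2 - x"] assms by (simp add: ln_Gamma_real_pos)
  have "(\<lambda>m. ln_Gamma_series (2 - x) m + (ln ((real m + 1) / real m) + ln ((real m + 2) / real m))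
        - x * (?h m + 1 / (real m + 2)))
      \<longlonglongrightarrow> ln (Gamma (2 - x)) + (0 + 0) - x * (euler_mascheroni - 1 + 0)"
    using LIMSEQ_ignore_initial_segment[OF lim_const_over_n[of 1], of 2]
    by (intro tendsto_intros gamma ratio shifted_harmonic_LIMSEQ) (simp_all add: add_ac)
  moreover have "\<forall>\<^sub>F m in sequentially.
      ln_Gamma_series (2 - x) m + (ln ((real m + 1) / real m) + ln ((real m + 2) / real m))
        - x * (?h m + 1 / (real m + 2))
      = (\<Sum>n<Suc m. ?f n)"
    using eventually_gt_at_top[of 0]
  proof eventually_elim
    case (elim m)
    then show ?case
      using assms
      by (simp add: ln_Gamma_series_two_minus ln_div sum_subtractf sum_negf
          sum_distrib_left algebra_simps)
  qed
  ultimately have "(\<lambda>m. \<Sum>n<Suc m. ?f n)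
      \<longlonglongrightarrow> ln (Gamma (2 - x)) + (0 + 0) - x * (euler_mascheroni - 1 + 0)"
    by (rule Lim_transform_eventually)
  then have "(\<lambda>m. \<Sum>n<m. ?f n)
      \<longlonglongrightarrow> ln (Gamma (2 - x)) + (0 + 0) - x * (euler_mascheroni - 1 + 0)"
    by (subst (asm) filterlim_sequentially_Suc)
  then show ?thesis
    by (simp add: sums_def algebra_simps)
qed

section \<open>The power series with zeta coefficients\<close>

lemma zeta_minus_one_sums:
  assumes "k \<ge> 2"
  shows "(\<lambda>n. 1 / (real n + 2) ^ k) sums (zeta (real k) - 1)"
proof -
  have "summable (\<lambda>n. 1 / real (Suc n) ^ k)"
    using inverse_power_summable[OF assms, where 'a = real]
    by (subst summable_Suc_iff) (simp add: inverse_eq_divide)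
  then have "(\<lambda>n. 1 / real (Suc n) ^ k) sums zeta (real k)"
    by (simp add: zeta_def powr_realpow summable_sums del: of_nat_Suc)
  then have "(\<lambda>n. 1 / real (Suc (Suc n)) ^ k) sums (zeta (real k) - 1 / real (Suc 0) ^ k)"
    by (subst sums_Suc_iff) simp
  then show ?thesis
    by (simp add: add_ac)
qed

lemma geometric_sums_from_2:
  fixes y :: real
  assumes "\<bar>y\<bar> < 1"
  shows "(\<lambda>k. y ^ (k + 2)) sums (y\<^sup>2 / (1 - y))"
  using sums_mult[OF geometric_sums[of y], of "y\<^sup>2"] assms
  by (simp add: power_add power2_eq_square mult_ac)

lemma log_series_from_2:
  fixes y :: real
  assumes "\<bar>y\<bar> < 1"
  shows "(\<lambda>k. y ^ (k + 2) / (real k + 2)) sums (- ln (1 - y) - y)"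
proof -
  have "(\<lambda>k. y ^ k / real k) sums (- ln (1 - y))"
    using sums_minus[OF ln_series'[of "- y"]] assms by simp
  then have "(\<lambda>k. y ^ (k + 2) / real (k + 2)) sums (- ln (1 - y) - (\<Sum>k<2. y ^ k / real k))"
    by (rule sums_split_initial_segment)
  then show ?thesis
    by (simp add: numeral_2_eq_2 add_ac)
qed

text \<open>
  The weight is bounded by 2, so the double series is dominated by a geometric series in $k$ of
  ratio $|x|/(n+2) \le |x|/2 < 1$ whose sum is $O(n^{-2})$.
\<close>
lemma double_series_summable:
  fixes x :: real
  assumes "\<bar>x\<bar> < 2"
  shows "(\<lambda>(n, k). (real k + 3) / (real k + 2) * (x / (real n + 2)) ^ (k + 2))
    summable_on (UNIV \<times> UNIV :: (nat \<times> nat) set)"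
proof -
  define y where "y = (\<lambda>n::nat. \<bar>x\<bar> / (real n + 2))"
  have y_nonneg: "y n \<ge> 0" for n
    by (simp add: y_def)
  have y_le: "y n \<le> \<bar>x\<bar> / 2" for n
    unfolding y_def by (intro divide_left_mono) auto
  have y_less: "y n < 1" for n
    using y_le[of n] assms by linarith
  have "summable (\<lambda>n. 1 / (real n + 2)\<^sup>2)"
    using zeta_minus_one_sums[of 2] by (simp add: sums_iff)
  then have "summable (\<lambda>n. 2 * \<bar>x\<bar>\<^sup>2 / (1 - \<bar>x\<bar> / 2) * (1 / (real n + 2)\<^sup>2))"
    by (rule summable_mult)
  then have "summable (\<lambda>n. 2 * ((y n)\<^sup>2 / (1 - y n)))"
  proof (rule summable_comparison_test[rotated], intro exI allI impI)
    fix n :: nat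
    have "(y n)\<^sup>2 / (1 - y n) \<le> (y n)\<^sup>2 / (1 - \<bar>x\<bar> / 2)"
      using y_le[of n] y_less[of n] assms by (intro divide_left_mono) auto
    then show "norm (2 * ((y n)\<^sup>2 / (1 - y n)))
        \<le> 2 * \<bar>x\<bar>\<^sup>2 / (1 - \<bar>x\<bar> / 2) * (1 / (real n + 2)\<^sup>2)"
      using y_less[of n] by (simp add: y_def power_divide mult_ac)
  qed
  then have outer: "(\<lambda>n. 2 * ((y n)\<^sup>2 / (1 - y n))) summable_on UNIV"
    using y_less by (subst summable_on_UNIV_nonneg_real_iff) (auto simp: less_imp_le)
  have inner: "((\<lambda>k. 2 * y n ^ (k + 2)) has_sum (2 * ((y n)\<^sup>2 / (1 - y n)))) UNIV" for n
    using y_less[of n] y_nonneg[of n]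
    by (intro sums_nonneg_imp_has_sum sums_mult geometric_sums_from_2) auto
  have "(\<lambda>(n, k). 2 * y n ^ (k + 2)) summable_on (UNIV \<times> UNIV :: (nat \<times> nat) set)"
    by (rule summable_on_SigmaI[OF _ outer]) (use inner y_nonneg in auto)
  then have "(\<lambda>p. norm ((\<lambda>(n, k). (real k + 3) / (real k + 2) * (x / (real n + 2)) ^ (k + 2)) p))
      summable_on (UNIV \<times> UNIV :: (nat \<times> nat) set)"
  proof (rule Infinite_Sum.abs_summable_on_comparison_test', safe)
    fix n k :: nat
    have "(real k + 3) / (real k + 2) * y n ^ (k + 2) \<le> 2 * y n ^ (k + 2)"
      using y_nonneg[of n] by (intro mult_right_mono) (auto simp: field_simps)
    then show "norm ((real k + 3) / (real k + 2) * (x / (real n + 2)) ^ (k + 2))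
        \<le> 2 * y n ^ (k + 2)"
      by (simp add: y_def abs_mult power_abs)
  qed
  then show ?thesis
    by (rule abs_summable_summable)
qed

text \<open>
  Both sides are the same unconditionally convergent double sum of
  $\frac{k+3}{k+2} (\frac{x}{n+2})^{k+2}$ over $n, k \ge 0$: summing over $n$ first produces
  the values of zeta, summing over $k$ first the series for $\psi^{(0)}$ and $\ln \Gamma$.
\<close>
lemma zeta_minus_one_power_series:
  fixes x :: real
  assumes "\<bar>x\<bar> < 2"
  shows "(\<lambda>k. (real k + 3) / (real k + 2) * (zeta (real (k + 2)) - 1) * x ^ (k + 2))
    sums (2 * (1 - euler_mascheroni) * x + ln (Gamma (2 - x)) - x * Digamma (2 - x))"
proof -
  define f where "f = (\<lambda>(n::nat, k::nat).
    (real k + 3) / (real k + 2) * (x / (real n + 2)) ^ (k + 2))"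
  have "f summable_on UNIV \<times> UNIV"
    unfolding f_def using double_series_summable[OF assms] .
  then obtain S where S: "(f has_sum S) (UNIV \<times> UNIV)"
    by (auto simp: summable_on_def)
  then have S': "((\<lambda>(k, n). f (n, k)) has_sum S) (UNIV \<times> UNIV)"
    by (subst (asm) has_sum_swap)

  have rows: "(\<lambda>k. f (n, k)) sums
      ((x / (real n + 2 - x) - x / (real n + 2))
        + (- ln (1 - x / (real n + 2)) - x / (real n + 2)))" for n
  proof -
    let ?y = "x / (real n + 2)"
    have "\<bar>?y\<bar> < 1"
      using assms by (simp add: field_simps)
    then have "(\<lambda>k. ?y ^ (k + 2) + ?y ^ (k + 2) / (real k + 2))
        sums (?y\<^sup>2 / (1 - ?y) + (- ln (1 - ?y) - ?y))"
      by (intro sums_add geometric_sums_from_2 log_series_from_2)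
    also have "(\<lambda>k. ?y ^ (k + 2) + ?y ^ (k + 2) / (real k + 2)) = (\<lambda>k. f (n, k))"
    proof
      fix k
      have weight: "(real k + 3) / (real k + 2) = 1 + 1 / (real k + 2)"
        by (simp add: field_simps)
      show "?y ^ (k + 2) + ?y ^ (k + 2) / (real k + 2) = f (n, k)"
        unfolding f_def prod.case weight
        by (simp only: distrib_right mult_1_left times_divide_eq_left)
    qed
    also have "?y\<^sup>2 / (1 - ?y) = x / (real n + 2 - x) - ?y"
    proof -
      have "real n + 2 - x \<noteq> 0"
        using assms by auto
      then show ?thesis
        by (simp add: divide_simps power2_eq_square) (simp add: algebra_simps)
    qed
    finally show ?thesis .
  qed
  have columns: "(\<lambda>n. f (n, k)) sums
      ((real k + 3) / (real k + 2) * (zeta (real (k + 2)) - 1) * x ^ (k + 2))" for k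
    using sums_mult[OF zeta_minus_one_sums[of "k + 2"],
        of "(real k + 3) / (real k + 2) * x ^ (k + 2)"]
    by (simp add: f_def power_divide mult_ac)

  have "(\<lambda>k. f (n, k)) summable_on UNIV" for n
    using summable_on_SigmaD1[of "\<lambda>n k. f (n, k)" UNIV "\<lambda>_. UNIV" n] S
    by (auto simp: summable_on_def)
  then have row_sum: "((\<lambda>k. f (n, k)) has_sum
      ((x / (real n + 2 - x) - x / (real n + 2))
        + (- ln (1 - x / (real n + 2)) - x / (real n + 2)))) UNIV" for n
    using has_sum_imp_sums rows sums_unique2 by (metis has_sum_infsum)
  have "(\<lambda>n. f (n, k)) summable_on UNIV" for k
    using summable_on_SigmaD1[of "\<lambda>k n. f (n, k)" UNIV "\<lambda>_. UNIV" k] S'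
    by (auto simp: summable_on_def)
  then have column_sum: "((\<lambda>n. f (n, k)) has_sum
      ((real k + 3) / (real k + 2) * (zeta (real (k + 2)) - 1) * x ^ (k + 2))) UNIV" for k
    using has_sum_imp_sums columns sums_unique2 by (metis has_sum_infsum)

  have "(\<lambda>n. (x / (real n + 2 - x) - x / (real n + 2))
      + (- ln (1 - x / (real n + 2)) - x / (real n + 2))) sums S"
    using has_sum_SigmaD[OF S row_sum] by (rule has_sum_imp_sums)
  moreover have "(\<lambda>n. (x / (real n + 2 - x) - x / (real n + 2))
      + (- ln (1 - x / (real n + 2)) - x / (real n + 2)))
      sums (x * (1 - euler_mascheroni - Digamma (2 - x))
        + ((1 - euler_mascheroni) * x + ln (Gamma (2 - x))))"
    using assms by (intro sums_add Digamma_partial_fractions ln_Gamma_logarithmic_series) auto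
  ultimately have "S = x * (1 - euler_mascheroni - Digamma (2 - x))
        + ((1 - euler_mascheroni) * x + ln (Gamma (2 - x)))"
    by (rule sums_unique2)
  then have "S = 2 * (1 - euler_mascheroni) * x + ln (Gamma (2 - x)) - x * Digamma (2 - x)"
    by (simp add: algebra_simps)
  moreover have "(\<lambda>k. (real k + 3) / (real k + 2) * (zeta (real (k + 2)) - 1) * x ^ (k + 2)) sums S"
    using has_sum_SigmaD[OF S'] column_sum by (intro has_sum_imp_sums) simp
  ultimately show ?thesis
    by (simp only:)
qed

section \<open>Fibonacci and Lucas weights\<close>

lemma alpha_beta_facts:
  shows alpha_square: "\<alpha>\<^sup>2 = \<alpha> + 1" and beta_square: "\<beta>\<^sup>2 = \<beta> + 1"
    and beta_eq: "\<beta> = 1 - \<alpha>" and abs_alpha_less: "\<bar>\<alpha>\<bar> < 2" and abs_beta_less: "\<bar>\<beta>\<bar> < 2"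
proof -
  have "sqrt 5 < 3"
    by (rule real_less_lsqrt) auto
  moreover have "sqrt 5 \<ge> 0"
    by simp
  ultimately show "\<bar>\<alpha>\<bar> < 2" "\<bar>\<beta>\<bar> < 2"
    by (auto simp: alpha_def beta_def abs_less_iff field_simps)
  show "\<alpha>\<^sup>2 = \<alpha> + 1" "\<beta>\<^sup>2 = \<beta> + 1" "\<beta> = 1 - \<alpha>"
    by (simp_all add: alpha_def beta_def power2_eq_square field_simps)
qed

lemma lucas_closed_form: "real (lucas n) = \<alpha> ^ n + \<beta> ^ n"
proof (induction n rule: lucas.induct)
  case (3 n)
  have "\<alpha> ^ Suc (Suc n) = \<alpha> ^ n * \<alpha>\<^sup>2" "\<beta> ^ Suc (Suc n) = \<beta> ^ n * \<beta>\<^sup>2"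
    by (simp_all add: power2_eq_square mult_ac)
  then show ?case
    using 3 by (simp add: alpha_square beta_square algebra_simps)
qed (simp_all add: beta_eq)

text \<open>
  The argument depends only on the Binet form $a \alpha^n + b \beta^n$ of the weights, by
  linearity in $a$ and $b$; the Lucas and the Fibonacci numbers are the cases $a = b = 1$ and $a = -b = 1/\sqrt5$.
\<close>
lemma zeta_series_Binet_weights:
  fixes u :: "nat \<Rightarrow> nat" and a b :: real
  assumes u: "\<And>n. real (u n) = a * \<alpha> ^ n + b * \<beta> ^ n"
  shows "(\<lambda>n. \<Sum>k = 2..n. (real k + 1) * (zeta (real k) - 1) / real k * real (u (k + m)))
    \<longlonglongrightarrow> 2 * (1 - euler_mascheroni) * real (u (m + 1))
      + a * \<alpha> ^ m * (ln (Gamma (\<beta>\<^sup>2)) - \<alpha> * Digamma (\<beta>\<^sup>2))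
      + b * \<beta> ^ m * (ln (Gamma (\<alpha>\<^sup>2)) - \<beta> * Digamma (\<alpha>\<^sup>2))"
    (is "?s \<longlonglongrightarrow> ?L")
proof -
  let ?g = "\<lambda>k. (real k + 1) * (zeta (real k) - 1) / real k * real (u (k + m))"
  have squares: "2 - \<alpha> = \<beta>\<^sup>2" "2 - \<beta> = \<alpha>\<^sup>2"
    by (simp_all only: alpha_square beta_square) (simp_all add: beta_eq)
  have "(\<lambda>k. a * \<alpha> ^ m * ((real k + 3) / (real k + 2) * (zeta (real (k + 2)) - 1) * \<alpha> ^ (k + 2))
        + b * \<beta> ^ m * ((real k + 3) / (real k + 2) * (zeta (real (k + 2)) - 1) * \<beta> ^ (k + 2)))
      sums (a * \<alpha> ^ m * (2 * (1 - euler_mascheroni) * \<alpha> + ln (Gamma (\<beta>\<^sup>2)) - \<alpha> * Digamma (\<beta>\<^sup>2))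
        + b * \<beta> ^ m * (2 * (1 - euler_mascheroni) * \<beta> + ln (Gamma (\<alpha>\<^sup>2)) - \<beta> * Digamma (\<alpha>\<^sup>2)))"
    using zeta_minus_one_power_series[OF abs_alpha_less]
      zeta_minus_one_power_series[OF abs_beta_less]
    unfolding squares by (intro sums_add sums_mult)
  also have "(\<lambda>k. a * \<alpha> ^ m * ((real k + 3) / (real k + 2) * (zeta (real (k + 2)) - 1) * \<alpha> ^ (k + 2))
        + b * \<beta> ^ m * ((real k + 3) / (real k + 2) * (zeta (real (k + 2)) - 1) * \<beta> ^ (k + 2)))
      = (\<lambda>k. ?g (k + 2))"
  proof
    fix k
    let ?w = "(real k + 3) / (real k + 2) * (zeta (real (k + 2)) - 1)"
    have "?g (k + 2) = ?w * real (u (k + 2 + m))"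
      by (simp add: add_ac)
    also have "\<dots> = a * \<alpha> ^ m * (?w * \<alpha> ^ (k + 2)) + b * \<beta> ^ m * (?w * \<beta> ^ (k + 2))"
      unfolding u power_add by (simp only: distrib_left mult_ac)
    finally show "a * \<alpha> ^ m * (?w * \<alpha> ^ (k + 2)) + b * \<beta> ^ m * (?w * \<beta> ^ (k + 2)) = ?g (k + 2)"
      by simp
  qed
  also have "a * \<alpha> ^ m * (2 * (1 - euler_mascheroni) * \<alpha> + ln (Gamma (\<beta>\<^sup>2)) - \<alpha> * Digamma (\<beta>\<^sup>2))
        + b * \<beta> ^ m * (2 * (1 - euler_mascheroni) * \<beta> + ln (Gamma (\<alpha>\<^sup>2)) - \<beta> * Digamma (\<alpha>\<^sup>2)) = ?L"
    by (simp add: u algebra_simps)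
  finally have "(\<lambda>n. \<Sum>k<n. ?g (k + 2)) \<longlonglongrightarrow> ?L"
    by (simp only: sums_def)
  moreover have "(\<Sum>k<n. ?g (k + 2)) = ?s (n + 1)" for n
    by (induction n) simp_all
  ultimately have "(\<lambda>n. ?s (n + 1)) \<longlonglongrightarrow> ?L"
    by simp
  then show ?thesis
    by (rule LIMSEQ_offset)
qed

theorem theorem2p0p2:
  fixes m :: nat
  shows
    "((\<lambda>n. \<Sum>k = 2..n. (real k + 1) * (zeta (real k) - 1) / real k * real (lucas (k + m)))
      \<longlonglongrightarrow>
        2 * (1 - euler_mascheroni) * real (lucas (m + 1))
        + \<alpha> ^ m * (ln (Gamma (\<beta>\<^sup>2)) - \<alpha> * Digamma (\<beta>\<^sup>2))
        + \<beta> ^ m * (ln (Gamma (\<alpha>\<^sup>2)) - \<beta> * Digamma (\<alpha>\<^sup>2)))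
     \<and>
     ((\<lambda>n. \<Sum>k = 2..n. (real k + 1) * (zeta (real k) - 1) / real k * real (fib (k + m)))
      \<longlonglongrightarrow>
        2 * (1 - euler_mascheroni) * real (fib (m + 1))
        + \<alpha> ^ m / sqrt 5 * (ln (Gamma (\<beta>\<^sup>2)) - \<alpha> * Digamma (\<beta>\<^sup>2))
        - \<beta> ^ m / sqrt 5 * (ln (Gamma (\<alpha>\<^sup>2)) - \<beta> * Digamma (\<alpha>\<^sup>2)))"
proof
  have "real (lucas n) = 1 * \<alpha> ^ n + 1 * \<beta> ^ n" for n
    by (simp add: lucas_closed_form)
  from zeta_series_Binet_weights[of lucas 1 1 m, OF this]
  show "(\<lambda>n. \<Sum>k = 2..n. (real k + 1) * (zeta (real k) - 1) / real k * real (lucas (k + m)))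
      \<longlonglongrightarrow> 2 * (1 - euler_mascheroni) * real (lucas (m + 1))
        + \<alpha> ^ m * (ln (Gamma (\<beta>\<^sup>2)) - \<alpha> * Digamma (\<beta>\<^sup>2))
        + \<beta> ^ m * (ln (Gamma (\<alpha>\<^sup>2)) - \<beta> * Digamma (\<alpha>\<^sup>2))"
    by (simp only: mult_1_left)
next
  have "real (fib n) = 1 / sqrt 5 * \<alpha> ^ n + (- 1 / sqrt 5) * \<beta> ^ n" for n
    using fib_closed_form[of n] by (simp add: alpha_def beta_def diff_divide_distrib)
  from zeta_series_Binet_weights[of fib "1 / sqrt 5" "- 1 / sqrt 5" m, OF this]
  show "(\<lambda>n. \<Sum>k = 2..n. (real k + 1) * (zeta (real k) - 1) / real k * real (fib (k + m)))
      \<longlonglongrightarrow> 2 * (1 - euler_mascheroni) * real (fib (m + 1))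
        + \<alpha> ^ m / sqrt 5 * (ln (Gamma (\<beta>\<^sup>2)) - \<alpha> * Digamma (\<beta>\<^sup>2))
        - \<beta> ^ m / sqrt 5 * (ln (Gamma (\<alpha>\<^sup>2)) - \<beta> * Digamma (\<alpha>\<^sup>2))"
    by simp
qed

end
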